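(* Fix $\ell>0$ and any function $\kappa:\mathbb R^m\to\mathbb R^m$. For every $h\in[H]$, $s\in\mathcal S$, $b\in\mathcal B$, $a\in\mathcal A_h(s)$, $\hat F\in\mathbb R^m$ and $t\in[S+1]$, $$\hat V^{s,a}_{h,b}(t,\hat F)=\max_{\mathbf b=(b_t,\dots,b_S)\in\mathcal B^{S-t+1}}\Big\{\sum_{s'=t}^S P_h(s'\mid s,a)\bar V^*_{h+1}(s',b_{s'})\ :\ c_h(s,a)+\hat f^{s,a}_{h,\mathbf b}(t,\hat F)\le\kappa(b)\Big\}$$ (with $\max\emptyset=-\infty$ and $0\cdot(-\infty)=0$). Moreover, if $\lceil\cdot\rceil_\ell$ and $\kappa$ are both replaced by the identity function, then $\max_{a\in\mathcal A_h(s)}\big[r_h(s,a)+\hat V^{s,a}_{h,b}(1,0)\big]=\bar V^*_h(s,b)$.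
   Context: Cost-accumulating MDP. Fix $H,m\in\mathbb N$. A finite-horizon tabular cost-accumulating MDP consists of: - states $\mathcal S=\{1,\dots,S\}$; - finite action sets $\mathcal A_h(s)$; - transitions $P_h(\cdot\mid s,a)$; - expected rewards $r_h(s,a)$; - deterministic costs $c_h(s,a)\in\mathbb R^m$; - an initial state $s_0$. Vector inequalities are componentwise. SR functions. Let $f:\mathbb R^m\times\mathbb R^m\to\mathbb R^m$ satisfy: - $f$ is associative; - $f$ is componentwise non-decreasing in each argument; - $f$ is $1$-Lipschitz in each argument for $\|\cdot\|_\infty$; - $f(0,x)=f(x,0)=x$. Let $g:[0,1]\to[0,1]$ satisfy $g(0)=0$. Write $f_{s'}y_{s'}=f(y_1,f(y_2,\dots,y_S))$. Assume $x\mapsto f_{s'}g(p_{s'})x_{s'}$ is $1$-Lipschitz for $\|\cdot\|_\infty$ for every probability vector $p$. SR cost. For deterministic history-dependent policies, $C^\pi_{H+1}\equiv0$ and $C^\pi_h(\tau_h)=c_h(s,a)+f_{s'}g(P_h(s'\mid s,a))C^\pi_{h+1}(\tau_h,a,s')$. $\mathcal B$ is the finite set of all values $C^\pi_h(\tau_h)$. Reduced optimal values. $\bar V^*_{H+1}(s,b)=0$ if $b\ge0$ and $-\infty$ otherwise. For $h\in[H]$, $\bar V^*_h(s,b)$ is the max of $r_h(s,a)+\sum_{s':P_h(s'|s,a)>0}P_h(s'\mid s,a)\bar V^*_{h+1}(s',b_{s'})$ over $a\in\mathcal A_h(s)$ and $\mathbf b\in\mathcal B^S$ with $c_h(s,a)+f_{s'}g(P_h(s'\mid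 s,a))b_{s'}\le b$. Rounding. $\lceil x\rceil_\ell=\lceil x/\ell\rceil\ell$ componentwise. Dynamically rounded aggregate. $\hat f^{s,a}_{h,\mathbf b}(S+1,F)=F$ and $\hat f^{s,a}_{h,\mathbf b}(t,F)=\hat f^{s,a}_{h,\mathbf b}\big(t+1,\lceil f(F,g(P_h(t\mid s,a))b_t)\rceil_\ell\big)$. Approximate dynamic program. $\hat V^{s,a}_{h,b}(S+1,\hat F)=0$ if $c_h(s,a)+\hat F\le\kappa(b)$ and $-\infty$ otherwise. For $t\in[S]$, $$\hat V^{s,a}_{h,b}(t,\hat F)=\max_{b_t\in\mathcal B}\Big[P_h(t\mid s,a)\bar V^*_{h+1}(t,b_t)+\hat V^{s,a}_{h,b}\big(t+1,\lceil f(\hat F,g(P_h(t\mid s,a))b_t)\rceil_\ell\big)\Big].$$ *)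

theory Defs
  imports "HOL-Analysis.Analysis"
begin

text \<open>
  States are the numbers \<open>1, \<dots>, nstates M\<close>, time steps the numbers \<open>1, \<dots>, horizon M\<close>.
  The order \<open>\<le>\<close> on \<open>real ^ 'm\<close> is componentwise, and \<open>infnorm\<close> is the maximum norm.
\<close>

record ('a, 'm) cost_mdp =
  horizon :: nat
  nstates :: nat
  actions :: "nat \<Rightarrow> nat \<Rightarrow> 'a set"
  trans_prob :: "nat \<Rightarrow> nat \<Rightarrow> 'a \<Rightarrow> nat \<Rightarrow> real"
  reward :: "nat \<Rightarrow> nat \<Rightarrow> 'a \<Rightarrow> real"
  cost :: "nat \<Rightarrow> nat \<Rightarrow> 'a \<Rightarrow> real ^ ('m::finite)"
  init :: nat

definition prob_vector :: "nat \<Rightarrow> (nat \<Rightarrow> real) \<Rightarrow> bool" where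
  "prob_vector S p \<longleftrightarrow> (\<forall>s\<in>{1..S}. 0 \<le> p s) \<and> (\<Sum>s=1..S. p s) = 1"

definition is_cost_mdp :: "('a, 'm::finite) cost_mdp \<Rightarrow> bool" where
  "is_cost_mdp M \<longleftrightarrow>
     init M \<in> {1..nstates M} \<and>
     (\<forall>h\<in>{1..horizon M}. \<forall>s\<in>{1..nstates M}.
        finite (actions M h s) \<and>
        (\<forall>a\<in>actions M h s. prob_vector (nstates M) (trans_prob M h s a)))"

text \<open>\<open>f(y\<^sub>1, f(y\<^sub>2, \<dots>, f(y\<^sub>S\<^sub>-\<^sub>1, y\<^sub>S)))\<close>, for \<open>S \<ge> 1\<close>.\<close>

definition aggregate :: "('v \<Rightarrow> 'v \<Rightarrow> 'v) \<Rightarrow> nat \<Rightarrow> (nat \<Rightarrow> 'v) \<Rightarrow> 'v" where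
  "aggregate f S y = foldr f (map y [1..<S]) (y S)"

text \<open>
  In the last clause the maximum norm on \<open>S\<close>-tuples of vectors is the maximum of the
  \<open>infnorm\<close>s of the entries.
\<close>

definition sr_functions ::
  "nat \<Rightarrow> (real ^ ('m::finite) \<Rightarrow> real ^ 'm \<Rightarrow> real ^ 'm) \<Rightarrow> (real \<Rightarrow> real) \<Rightarrow> bool" where
  "sr_functions S f g \<longleftrightarrow>
     (\<forall>x y z. f (f x y) z = f x (f y z)) \<and>
     (\<forall>y. mono (\<lambda>x. f x y)) \<and> (\<forall>x. mono (\<lambda>y. f x y)) \<and>
     (\<forall>x x' y. infnorm (f x y - f x' y) \<le> infnorm (x - x')) \<and>
     (\<forall>x y y'. infnorm (f x y - f x y') \<le> infnorm (y - y')) \<and>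
     (\<forall>x. f 0 x = x \<and> f x 0 = x) \<and>
     g ` {0..1} \<subseteq> {0..1} \<and> g 0 = 0 \<and>
     (\<forall>p. prob_vector S p \<longrightarrow>
        (\<forall>x y. infnorm (aggregate f S (\<lambda>s. g (p s) *\<^sub>R x s) - aggregate f S (\<lambda>s. g (p s) *\<^sub>R y s))
               \<le> Max ((\<lambda>s. infnorm (x s - y s)) ` {1..S})))"

text \<open>
  The history \<open>(s\<^sub>1, a\<^sub>1, \<dots>, s\<^sub>h\<^sub>-\<^sub>1, a\<^sub>h\<^sub>-\<^sub>1, s\<^sub>h)\<close> is represented by the list of
  pairs \<open>(s\<^sub>k, a\<^sub>k)\<close>, \<open>k < h\<close>, together with the current state \<open>s\<^sub>h\<close>. Histories start in the
  initial state; transitions of probability zero are allowed.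
\<close>

type_synonym 'a history = "(nat \<times> 'a) list \<times> nat"

definition extend :: "'a history \<Rightarrow> 'a \<Rightarrow> nat \<Rightarrow> 'a history" where
  "extend \<tau> a s' = (fst \<tau> @ [(snd \<tau>, a)], s')"

inductive is_history :: "('a, 'm::finite) cost_mdp \<Rightarrow> nat \<Rightarrow> 'a history \<Rightarrow> bool"
  for M where
  start: "is_history M 1 ([], init M)"
| step: "\<lbrakk>is_history M h \<tau>; h \<le> horizon M; a \<in> actions M h (snd \<tau>); s' \<in> {1..nstates M}\<rbrakk>
     \<Longrightarrow> is_history M (h + 1) (extend \<tau> a s')"

definition is_policy :: "('a, 'm::finite) cost_mdp \<Rightarrow> (nat \<Rightarrow> 'a history \<Rightarrow> 'a) \<Rightarrow> bool" where
  "is_policy M \<pi> \<longleftrightarrow>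
     (\<forall>h\<in>{1..horizon M}. \<forall>\<tau>. is_history M h \<tau> \<longrightarrow> \<pi> h \<tau> \<in> actions M h (snd \<tau>))"

function sr_cost ::
  "('a, 'm::finite) cost_mdp \<Rightarrow> (real ^ 'm \<Rightarrow> real ^ 'm \<Rightarrow> real ^ 'm) \<Rightarrow> (real \<Rightarrow> real) \<Rightarrow>
   (nat \<Rightarrow> 'a history \<Rightarrow> 'a) \<Rightarrow> nat \<Rightarrow> 'a history \<Rightarrow> real ^ 'm" where
  "sr_cost M f g \<pi> h \<tau> =
     (if h > horizon M then 0
      else cost M h (snd \<tau>) (\<pi> h \<tau>) +
        aggregate f (nstates M)
          (\<lambda>s'. g (trans_prob M h (snd \<tau>) (\<pi> h \<tau>) s') *\<^sub>R
                sr_cost M f g \<pi> (h + 1) (extend \<tau> (\<pi> h \<tau>) s')))"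
  by pat_completeness auto
termination
  by (relation "Wellfounded.measure (\<lambda>(M, f, g, \<pi>, h, \<tau>). Suc (horizon M) - h)") auto

declare sr_cost.simps [simp del]

definition budgets ::
  "('a, 'm::finite) cost_mdp \<Rightarrow> (real ^ 'm \<Rightarrow> real ^ 'm \<Rightarrow> real ^ 'm) \<Rightarrow> (real \<Rightarrow> real) \<Rightarrow>
   (real ^ 'm) set" where
  "budgets M f g = {sr_cost M f g \<pi> h \<tau> | \<pi> h \<tau>.
     is_policy M \<pi> \<and> h \<in> {1..horizon M + 1} \<and> is_history M h \<tau>}"

text \<open>
  Maximum of a finite set with values in the reals extended by \<open>-\<infinity>\<close>, where the maximum of
  the empty set is \<open>-\<infinity>\<close>. Multiplication on \<^typ>\<open>ereal\<close> satisfies \<open>0 * (-\<infinity>) = 0\<close>.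
\<close>

definition max_ninf :: "ereal set \<Rightarrow> ereal" where
  "max_ninf X = (if X = {} then -\<infinity> else Max X)"

function opt_val ::
  "('a, 'm::finite) cost_mdp \<Rightarrow> (real ^ 'm \<Rightarrow> real ^ 'm \<Rightarrow> real ^ 'm) \<Rightarrow> (real \<Rightarrow> real) \<Rightarrow>
   nat \<Rightarrow> nat \<Rightarrow> real ^ 'm \<Rightarrow> ereal" where
  "opt_val M f g h s b =
     (if h > horizon M then (if b \<ge> 0 then 0 else -\<infinity>)
      else max_ninf
        {ereal (reward M h s a) +
         (\<Sum>s' | s' \<in> {1..nstates M} \<and> trans_prob M h s a s' > 0.
            ereal (trans_prob M h s a s') * opt_val M f g (h + 1) s' (\<b> s')) | a \<b>.
         a \<in> actions M h s \<and> \<b> \<in> {1..nstates M} \<rightarrow>\<^sub>E budgets M f g \<and>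
         cost M h s a + aggregate f (nstates M) (\<lambda>s'. g (trans_prob M h s a s') *\<^sub>R \<b> s') \<le> b})"
  by pat_completeness auto
termination
  by (relation "Wellfounded.measure (\<lambda>(M, f, g, h, s, b). Suc (horizon M) - h)") auto

declare opt_val.simps [simp del]

definition round_up :: "real \<Rightarrow> real ^ ('m::finite) \<Rightarrow> real ^ 'm" where
  "round_up l x = (\<chi> i. of_int \<lceil>x $ i / l\<rceil> * l)"

text \<open>
  The next two functions take the rounding map \<open>\<rho>\<close> as a parameter; it is \<open>round_up l\<close>, or the
  identity for the exact program.
\<close>

function agg_hat ::
  "('a, 'm::finite) cost_mdp \<Rightarrow> (real ^ 'm \<Rightarrow> real ^ 'm \<Rightarrow> real ^ 'm) \<Rightarrow> (real \<Rightarrow> real) \<Rightarrow>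
   (real ^ 'm \<Rightarrow> real ^ 'm) \<Rightarrow> nat \<Rightarrow> nat \<Rightarrow> 'a \<Rightarrow> (nat \<Rightarrow> real ^ 'm) \<Rightarrow>
   nat \<Rightarrow> real ^ 'm \<Rightarrow> real ^ 'm" where
  "agg_hat M f g \<rho> h s a \<b> t F =
     (if t > nstates M then F
      else agg_hat M f g \<rho> h s a \<b> (t + 1) (\<rho> (f F (g (trans_prob M h s a t) *\<^sub>R \<b> t))))"
  by pat_completeness auto
termination
  by (relation "Wellfounded.measure (\<lambda>(M, f, g, \<rho>, h, s, a, \<b>, t, F). Suc (nstates M) - t)") auto

declare agg_hat.simps [simp del]

function val_hat ::
  "('a, 'm::finite) cost_mdp \<Rightarrow> (real ^ 'm \<Rightarrow> real ^ 'm \<Rightarrow> real ^ 'm) \<Rightarrow> (real \<Rightarrow> real) \<Rightarrow>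
   (real ^ 'm \<Rightarrow> real ^ 'm) \<Rightarrow> (real ^ 'm \<Rightarrow> real ^ 'm) \<Rightarrow> nat \<Rightarrow> nat \<Rightarrow> 'a \<Rightarrow> real ^ 'm \<Rightarrow>
   nat \<Rightarrow> real ^ 'm \<Rightarrow> ereal" where
  "val_hat M f g \<rho> \<kappa> h s a b t F =
     (if t > nstates M then (if cost M h s a + F \<le> \<kappa> b then 0 else -\<infinity>)
      else max_ninf
        ((\<lambda>b'. ereal (trans_prob M h s a t) * opt_val M f g (h + 1) t b' +
               val_hat M f g \<rho> \<kappa> h s a b (t + 1) (\<rho> (f F (g (trans_prob M h s a t) *\<^sub>R b'))))
         ` budgets M f g))"
  by pat_completeness auto
termination
  by (relation "Wellfounded.measure (\<lambda>(M, f, g, \<rho>, \<kappa>, h, s, a, b, t, F). Suc (nstates M) - t)") auto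

declare val_hat.simps [simp del]

text \<open>Finiteness of the set of budgets, so that all maxima above are over finite sets.\<close>

lemma is_history_state:
  assumes "is_cost_mdp M" "is_history M h \<tau>"
  shows "snd \<tau> \<in> {1..nstates M}"
  using assms(2,1) by cases (auto simp: is_cost_mdp_def extend_def)

lemma aggregate_cong:
  assumes "S \<ge> 1" "\<And>s. s \<in> {1..S} \<Longrightarrow> x s = y s"
  shows "aggregate f S x = aggregate f S y"
proof -
  have "map x [1..<S] = map y [1..<S]" using assms(2) by auto
  moreover have "x S = y S" using assms by auto
  ultimately show ?thesis unfolding aggregate_def by (metis (no_types))
qed

lemma finite_sr_costs:
  assumes M: "is_cost_mdp M" and "1 \<le> h" "h \<le> horizon M + 1"
  shows "finite {sr_cost M f g \<pi> h \<tau> | \<pi> \<tau>. is_policy M \<pi> \<and> is_history M h \<tau>}"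
  using assms(3,2)
proof (induction h rule: inc_induct)
  case base
  have "{sr_cost M f g \<pi> (horizon M + 1) \<tau> | \<pi> \<tau>.
          is_policy M \<pi> \<and> is_history M (horizon M + 1) \<tau>} \<subseteq> {0}"
    by (auto simp: sr_cost.simps)
  then show ?case using finite_subset by blast
next
  case (step h)
  let ?S = "nstates M"
  let ?C = "{sr_cost M f g \<pi> (Suc h) \<tau> | \<pi> \<tau>. is_policy M \<pi> \<and> is_history M (Suc h) \<tau>}"
  let ?D = "SIGMA s:{1..?S}. actions M h s \<times> ({1..?S} \<rightarrow>\<^sub>E ?C)"
  let ?F = "\<lambda>(s, a, y). cost M h s a + aggregate f ?S (\<lambda>s'. g (trans_prob M h s a s') *\<^sub>R y s')"
  have S: "?S \<ge> 1" using M by (auto simp: is_cost_mdp_def)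
  have h: "h \<in> {1..horizon M}" using step by auto
  have "finite ?C" using step.IH by simp
  then have "finite ?D"
    using M h by (intro finite_SigmaI finite_cartesian_product finite_PiE)
      (auto simp: is_cost_mdp_def)
  moreover have "{sr_cost M f g \<pi> h \<tau> | \<pi> \<tau>. is_policy M \<pi> \<and> is_history M h \<tau>} \<subseteq> ?F ` ?D"
  proof (safe)
    fix \<pi> xs s assume p: "is_policy M \<pi>" and t: "is_history M h (xs, s)"
    define a where "a = \<pi> h (xs, s)"
    define y where "y = (\<lambda>s'\<in>{1..?S}. sr_cost M f g \<pi> (Suc h) (extend (xs, s) a s'))"
    have s: "s \<in> {1..?S}" using is_history_state[OF M t] by simp
    have a: "a \<in> actions M h s" using p t h by (force simp: is_policy_def a_def)
    have "is_history M (Suc h) (extend (xs, s) a s')" if "s' \<in> {1..?S}" for s'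
      using is_history.step[OF t _ _ that, of a] h a by simp
    then have "y \<in> {1..?S} \<rightarrow>\<^sub>E ?C" using p unfolding y_def by fastforce
    then have "(s, a, y) \<in> ?D" using s a by simp
    moreover have "sr_cost M f g \<pi> h (xs, s) = ?F (s, a, y)"
    proof -
      have "aggregate f ?S (\<lambda>s'. g (trans_prob M h s a s') *\<^sub>R sr_cost M f g \<pi> (Suc h) (extend (xs, s) a s'))
        = aggregate f ?S (\<lambda>s'. g (trans_prob M h s a s') *\<^sub>R y s')"
        by (rule aggregate_cong[OF S]) (simp add: y_def)
      then show ?thesis using h by (subst sr_cost.simps) (simp add: a_def)
    qed
    ultimately show "sr_cost M f g \<pi> h (xs, s) \<in> ?F ` ?D" by blast
  qed
  ultimately show ?case using finite_surj by blast
qed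

lemma finite_budgets:
  assumes "is_cost_mdp M"
  shows "finite (budgets M f g)"
proof -
  have "budgets M f g = (\<Union>h\<in>{1..horizon M + 1}.
      {sr_cost M f g \<pi> h \<tau> | \<pi> \<tau>. is_policy M \<pi> \<and> is_history M h \<tau>})"
    unfolding budgets_def by blast
  then show ?thesis using finite_sr_costs[OF assms] by auto
qed

end

theory Submission
  imports Defs
begin

text \<open>The recursion maximises over the entries of a tuple one at a time. Choosing
  \<open>b_t\<close> and then a tuple on \<open>{t+1..S}\<close> is the same as choosing a tuple on
  \<open>{t..S}\<close>, so backward induction on \<open>t\<close> merges the nested maxima into one
  (\<open>val_hat_eq_max_ninf\<close>). Two facts about maxima with values in the reals and
  -\<infinity> carry the step: a summand other than \<infinity> moves inside a maximum, even an
  empty one (\<open>max_ninf_image_plus\<close>), and a maximum of maxima is the maximum over the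
  union (\<open>max_ninf_UN\<close>). That no summand is \<infinity> is
  \<open>opt_val_neq_PInf\<close>.

  Without rounding, the running aggregate is a left fold of \<open>f\<close> started at 0. By
  associativity and the unit law it equals the right-nested aggregate
  (\<open>agg_hat_id_eq_aggregate\<close>), so both programs have the same feasible tuples. Their
  objectives agree because successors of probability zero contribute 0.\<close>

text \<open>Translation by \<open>c\<close> is monotone, so it commutes with the maximum of a
  nonempty finite set. The empty set is where \<open>c \<noteq> \<infinity>\<close> enters.\<close>

lemma max_ninf_image_plus:
  assumes "finite X" "c \<noteq> \<infinity>"
  shows "c + max_ninf X = max_ninf ((+) c ` X)"
proof (cases "X = {}")
  case True
  then show ?thesis using assms(2) by (cases c) (auto simp: max_ninf_def)
next
  case False
  have "mono ((+) c)" by (auto intro: monoI add_left_mono)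
  from mono_Max_commute[OF this assms(1) False] False show ?thesis
    by (simp add: max_ninf_def)
qed

text \<open>On finite sets \<open>max_ninf\<close> is the supremum of the complete lattice
  \<open>ereal\<close>, whose bottom is -\<infinity>; empty sets thus need no separate
  treatment.\<close>

lemma max_ninf_UN:
  assumes "finite I" "\<And>i. i \<in> I \<Longrightarrow> finite (X i)"
  shows "max_ninf ((\<lambda>i. max_ninf (X i)) ` I) = max_ninf (\<Union>i\<in>I. X i)"
proof -
  have Sup: "max_ninf Y = Sup Y" if "finite Y" for Y
    using that by (auto simp: max_ninf_def bot_ereal_def Max_Sup)
  have "max_ninf ((\<lambda>i. max_ninf (X i)) ` I) = (SUP i\<in>I. Sup (X i))"
    using assms by (simp add: Sup)
  also have "\<dots> = Sup (\<Union>i\<in>I. X i)"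
    by (rule antisym) (auto intro!: SUP_least Sup_least intro: Sup_upper SUP_upper2)
  finally show ?thesis using assms by (simp add: Sup)
qed

lemma max_ninf_neq_PInf:
  assumes "finite X" "\<infinity> \<notin> X"
  shows "max_ninf X \<noteq> \<infinity>"
  using assms Max_in[OF assms(1)] by (metis max_ninf_def MInfty_neq_PInfty(1))

text \<open>The last element is split off because \<open>aggregate\<close> seeds its right fold with
  \<open>y S\<close> rather than with a unit.\<close>

lemma foldl_snoc_eq_foldr:
  assumes "\<And>x y z. f (f x y) z = f x (f y z)"
  shows "foldl f F (xs @ [z]) = f F (foldr f xs z)"
  by (induction xs arbitrary: F) (auto simp: assms)

lemma agg_hat_id_eq_foldl:
  assumes "t \<le> nstates M + 1"
  shows "agg_hat M f g id h s a \<b> t F =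
    foldl f F (map (\<lambda>s'. g (trans_prob M h s a s') *\<^sub>R \<b> s') [t..<nstates M + 1])"
  using assms
proof (induction t arbitrary: F rule: inc_induct)
  case base
  then show ?case by (simp add: agg_hat.simps)
next
  case (step t)
  then have "[t..<nstates M + 1] = t # [Suc t..<nstates M + 1]"
    by (simp add: upt_conv_Cons del: upt_Suc)
  then show ?case
    using step.hyps by (subst agg_hat.simps) (simp add: step.IH del: upt_Suc)
qed

lemma agg_hat_id_eq_aggregate:
  assumes "sr_functions (nstates M) f g" "nstates M \<ge> 1"
  shows "agg_hat M f g id h s a \<b> 1 0 =
    aggregate f (nstates M) (\<lambda>s'. g (trans_prob M h s a s') *\<^sub>R \<b> s')"
proof -
  have assoc: "f (f x y) z = f x (f y z)" and zero: "f 0 x = x" for x y z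
    using assms(1) by (auto simp: sr_functions_def)
  show ?thesis
    using assms(2) foldl_snoc_eq_foldr[of f 0, OF assoc]
    by (simp add: agg_hat_id_eq_foldl aggregate_def zero)
qed

text \<open>Entries before \<open>t\<close> have already been absorbed into \<open>F\<close>. This
  allows a tuple on later indices to be extended by one entry without changing its
  aggregate.\<close>

lemma agg_hat_cong:
  assumes "t \<le> nstates M + 1" "\<And>i. t \<le> i \<Longrightarrow> \<b> i = \<b>' i"
  shows "agg_hat M f g \<rho> h s a \<b> t F = agg_hat M f g \<rho> h s a \<b>' t F"
  using assms
proof (induction t arbitrary: F rule: inc_induct)
  case base
  then show ?case by (simp add: agg_hat.simps)
next
  case (step t)
  then show ?case
    by (subst (1 2) agg_hat.simps) simp
qed

text \<open>
  On \<^typ>\<open>ereal\<close> we have \<open>\<infinity> + (-\<infinity>) = \<infinity>\<close>, so an infinite summand could not be moved into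
  a maximum over an empty set.
\<close>

lemma opt_val_neq_PInf:
  assumes M: "is_cost_mdp M" and "1 \<le> h" "s \<in> {1..nstates M}"
  shows "opt_val M f g h s b \<noteq> \<infinity>"
proof (cases "h \<le> horizon M + 1")
  case False
  then show ?thesis by (simp add: opt_val.simps)
next
  case True
  then show ?thesis using assms(2,3)
  proof (induction h arbitrary: s b rule: inc_induct)
    case base
    then show ?case by (simp add: opt_val.simps)
  next
    case (step h)
    let ?S = "{1..nstates M}" and ?B = "budgets M f g"
    let ?p = "trans_prob M h s"
    let ?v = "\<lambda>(a, \<b>). ereal (reward M h s a) +
         (\<Sum>s' | s' \<in> ?S \<and> ?p a s' > 0. ereal (?p a s') * opt_val M f g (h + 1) s' (\<b> s'))"
    let ?X = "{ereal (reward M h s a) +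
         (\<Sum>s' | s' \<in> ?S \<and> ?p a s' > 0.
            ereal (?p a s') * opt_val M f g (h + 1) s' (\<b> s')) | a \<b>.
         a \<in> actions M h s \<and> \<b> \<in> ?S \<rightarrow>\<^sub>E ?B \<and>
         cost M h s a + aggregate f (nstates M) (\<lambda>s'. g (?p a s') *\<^sub>R \<b> s') \<le> b}"
    \<comment> \<open>Over a finite set the maximum is attained, so it is enough that no candidate
      value is \<infinity>.\<close>
    have "finite (actions M h s)" using M step by (auto simp: is_cost_mdp_def)
    then have "finite (actions M h s \<times> (?S \<rightarrow>\<^sub>E ?B))"
      by (intro finite_cartesian_product finite_PiE finite_budgets[OF M]) auto
    moreover have "?X \<subseteq> ?v ` (actions M h s \<times> (?S \<rightarrow>\<^sub>E ?B))" by fastforce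
    ultimately have "finite ?X" by (rule finite_surj)
    moreover have "\<infinity> \<notin> ?X"
    proof -
      \<comment> \<open>A positive finite factor gives \<infinity> only from \<infinity>, and a
        finite sum in \<open>ereal\<close> is \<infinity> only if some summand is.\<close>
      have "ereal (?p a s') * opt_val M f g (h + 1) s' c \<noteq> \<infinity>"
        if "s' \<in> ?S" "?p a s' > 0" for a s' c
        using step.IH[of s' c] that by (auto simp: ereal_mult_eq_PInfty)
      then have "(\<Sum>s' | s' \<in> ?S \<and> ?p a s' > 0.
          ereal (?p a s') * opt_val M f g (h + 1) s' (\<b> s')) \<noteq> \<infinity>" for a \<b>
        by (simp add: sum_Pinfty)
      then show ?thesis by auto
    qed
    ultimately have "max_ninf ?X \<noteq> \<infinity>" by (rule max_ninf_neq_PInf)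
    then show ?case using step.hyps by (subst opt_val.simps) simp
  qed
qed

text \<open>Backward induction on \<open>t\<close>, for all \<open>F\<close> at once since each step
  changes the accumulator. The rounding map \<open>\<rho>\<close> stays arbitrary, so that the lemma
  covers both the rounded and the exact program.\<close>

lemma val_hat_eq_max_ninf:
  fixes M :: "('a, 'm::finite) cost_mdp"
  assumes M: "is_cost_mdp M" and h: "h \<in> {1..horizon M}" and s: "s \<in> {1..nstates M}"
    and a: "a \<in> actions M h s" and t: "t \<in> {1..nstates M + 1}"
  shows "val_hat M f g \<rho> \<kappa> h s a b t F =
    max_ninf ((\<lambda>\<b>. \<Sum>s'=t..nstates M.
        ereal (trans_prob M h s a s') * opt_val M f g (h + 1) s' (\<b> s')) `
      {\<b> \<in> {t..nstates M} \<rightarrow>\<^sub>E budgets M f g.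
        cost M h s a + agg_hat M f g \<rho> h s a \<b> t F \<le> \<kappa> b})"
proof -
  let ?S = "nstates M" and ?B = "budgets M f g"
  let ?p = "trans_prob M h s a"
  let ?v = "\<lambda>s' c. ereal (?p s') * opt_val M f g (h + 1) s' c"
  let ?A = "\<lambda>t F. {\<b> \<in> {t..?S} \<rightarrow>\<^sub>E ?B. cost M h s a + agg_hat M f g \<rho> h s a \<b> t F \<le> \<kappa> b}"
  have finA: "finite (?A t F)" for t F
    by (rule finite_subset[of _ "{t..?S} \<rightarrow>\<^sub>E ?B"]) (auto intro!: finite_PiE finite_budgets[OF M])
  have v: "?v s' c \<noteq> \<infinity>" if "s' \<in> {1..?S}" for s' c
  proof -
    have "?p s' \<ge> 0" using M h s a that by (auto simp: is_cost_mdp_def prob_vector_def)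
    then show ?thesis using opt_val_neq_PInf[OF M _ that, of "h + 1" f g c]
      by (auto simp: ereal_mult_eq_PInfty)
  qed
  from t have "t \<le> ?S + 1" "1 \<le> t" by auto
  then show ?thesis
  proof (induction t arbitrary: F rule: inc_induct)
    case base
    \<comment> \<open>The index set \<open>{S+1..S}\<close> is empty and carries exactly one tuple,
      with sum 0; the maximum is therefore 0 or -\<infinity> according to the constraint.\<close>
    then show ?case by (auto simp: val_hat.simps agg_hat.simps max_ninf_def)
  next
    case (step t)
    let ?F = "\<lambda>c. \<rho> (f F (g (?p t) *\<^sub>R c))"
    let ?sum = "\<lambda>t \<b>. \<Sum>s'=t..?S. ?v s' (\<b> s')"
    have split: "{t..?S} = insert t {Suc t..?S}" using step by auto
    have sum_upd: "?sum t (\<b>(t := c)) = ?v t c + ?sum (Suc t) \<b>" for \<b> c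
      unfolding split by simp
    have agg_upd: "agg_hat M f g \<rho> h s a (\<b>(t := c)) t F =
        agg_hat M f g \<rho> h s a \<b> (Suc t) (?F c)" for \<b> c
      using step.hyps agg_hat_cong[of "Suc t" M "\<b>(t := c)" \<b>]
      by (subst agg_hat.simps) simp
    \<comment> \<open>Feasible tuples are sorted by their entry \<open>c\<close> at
      \<open>t\<close>: once \<open>c\<close> is absorbed into the accumulator, the same constraint
      is left for the remaining entries.\<close>
    have A: "?A t F = (\<Union>c\<in>?B. (\<lambda>\<b>. \<b>(t := c)) ` ?A (Suc t) (?F c))"
      unfolding split PiE_insert_eq by (auto simp: agg_upd)
    have "val_hat M f g \<rho> \<kappa> h s a b t F =
        max_ninf ((\<lambda>c. ?v t c + max_ninf (?sum (Suc t) ` ?A (Suc t) (?F c))) ` ?B)"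
      using step by (subst val_hat.simps) simp
    also have "\<dots> = max_ninf
        ((\<lambda>c. max_ninf ((+) (?v t c) ` ?sum (Suc t) ` ?A (Suc t) (?F c))) ` ?B)"
      using v[of t] finA step by (simp add: max_ninf_image_plus)
    also have "\<dots> = max_ninf (\<Union>c\<in>?B. (+) (?v t c) ` ?sum (Suc t) ` ?A (Suc t) (?F c))"
      by (intro max_ninf_UN finite_budgets[OF M] finite_imageI finA)
    also have "(\<Union>c\<in>?B. (+) (?v t c) ` ?sum (Suc t) ` ?A (Suc t) (?F c)) = ?sum t ` ?A t F"
      unfolding A image_UN image_image sum_upd ..
    finally show ?case .
  qed
qed

text \<open>With both maps the identity, the maximum over actions of the maxima over tuples becomes
  one maximum over pairs, which is the defining one of \<open>opt_val\<close>.\<close>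

lemma opt_val_eq_max_val_hat:
  fixes M :: "('a, 'm::finite) cost_mdp"
  assumes M: "is_cost_mdp M" and fg: "sr_functions (nstates M) f g"
    and h: "h \<in> {1..horizon M}" and s: "s \<in> {1..nstates M}"
  shows "max_ninf ((\<lambda>a. ereal (reward M h s a) + val_hat M f g id id h s a b 1 0) ` actions M h s)
    = opt_val M f g h s b"
proof -
  let ?S = "nstates M" and ?B = "budgets M f g"
  let ?v = "\<lambda>a s' c. ereal (trans_prob M h s a s') * opt_val M f g (h + 1) s' c"
  let ?A = "\<lambda>a. {\<b> \<in> {1..?S} \<rightarrow>\<^sub>E ?B. cost M h s a +
    aggregate f ?S (\<lambda>s'. g (trans_prob M h s a s') *\<^sub>R \<b> s') \<le> b}"
  let ?sum = "\<lambda>a \<b>. \<Sum>s' | s' \<in> {1..?S} \<and> trans_prob M h s a s' > 0. ?v a s' (\<b> s')"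
  have S: "?S \<ge> 1" using s by simp
  have finA: "finite (?A a)" for a
    by (rule finite_subset[of _ "{1..?S} \<rightarrow>\<^sub>E ?B"]) (auto intro!: finite_PiE finite_budgets[OF M])
  have sum: "(\<Sum>s'=1..?S. ?v a s' (\<b> s')) = ?sum a \<b>" if "a \<in> actions M h s" for a \<b>
  \<comment> \<open>The extra terms have probability zero and vanish even where
    \<open>opt_val\<close> is -\<infinity>, since 0 times -\<infinity> is 0 in
    \<open>ereal\<close>.\<close>
  proof (rule sum.mono_neutral_right)
    have "trans_prob M h s a s' \<ge> 0" if "s' \<in> {1..?S}" for s'
      using M h s \<open>a \<in> _\<close> that by (auto simp: is_cost_mdp_def prob_vector_def)
    then show "\<forall>s'\<in>{1..?S} - {s' \<in> {1..?S}. trans_prob M h s a s' > 0}. ?v a s' (\<b> s') = 0"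
      by (force simp: not_less dest: antisym)
  qed auto
  have "ereal (reward M h s a) + val_hat M f g id id h s a b 1 0 =
      max_ninf ((+) (ereal (reward M h s a)) ` ?sum a ` ?A a)" if "a \<in> actions M h s" for a
    using val_hat_eq_max_ninf[OF M h s that, of 1 f g id id b 0] finA sum[OF that]
    by (simp add: agg_hat_id_eq_aggregate[OF fg S, unfolded One_nat_def] max_ninf_image_plus)
  then have "max_ninf ((\<lambda>a. ereal (reward M h s a) + val_hat M f g id id h s a b 1 0) ` actions M h s)
      = max_ninf ((\<lambda>a. max_ninf ((+) (ereal (reward M h s a)) ` ?sum a ` ?A a)) ` actions M h s)"
    by simp
  also have "\<dots> = max_ninf (\<Union>a\<in>actions M h s. (+) (ereal (reward M h s a)) ` ?sum a ` ?A a)"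
    using M h s by (intro max_ninf_UN finite_imageI finA) (auto simp: is_cost_mdp_def)
  also have "(\<Union>a\<in>actions M h s. (+) (ereal (reward M h s a)) ` ?sum a ` ?A a) =
      {ereal (reward M h s a) + ?sum a \<b> | a \<b>. a \<in> actions M h s \<and> \<b> \<in> {1..?S} \<rightarrow>\<^sub>E ?B \<and>
        cost M h s a + aggregate f ?S (\<lambda>s'. g (trans_prob M h s a s') *\<^sub>R \<b> s') \<le> b}"
    by blast
  also have "max_ninf \<dots> = opt_val M f g h s b"
    \<comment> \<open>Only the right-hand side is unfolded; the other occurrence is the value at
      step \<open>h + 1\<close> inside \<open>?sum\<close>.\<close>
    using h by (subst (2) opt_val.simps) simp
  finally show ?thesis .
qed

theorem mainTheorem8:
  fixes M :: "('a, 'm::finite) cost_mdp"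
    and f :: "real ^ 'm \<Rightarrow> real ^ 'm \<Rightarrow> real ^ 'm"
    and g :: "real \<Rightarrow> real"
    and l :: real
    and \<kappa> :: "real ^ 'm \<Rightarrow> real ^ 'm"
  assumes "is_cost_mdp M"
    and "sr_functions (nstates M) f g"
    and "l > 0"
  shows "(\<forall>h\<in>{1..horizon M}. \<forall>s\<in>{1..nstates M}. \<forall>b\<in>budgets M f g. \<forall>a\<in>actions M h s.
            \<forall>F. \<forall>t\<in>{1..nstates M + 1}.
              val_hat M f g (round_up l) \<kappa> h s a b t F =
              max_ninf {\<Sum>s'=t..nstates M.
                  ereal (trans_prob M h s a s') * opt_val M f g (h + 1) s' (\<b> s') | \<b>.
                \<b> \<in> {t..nstates M} \<rightarrow>\<^sub>E budgets M f g \<and>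
                cost M h s a + agg_hat M f g (round_up l) h s a \<b> t F \<le> \<kappa> b})
       \<and> (\<forall>h\<in>{1..horizon M}. \<forall>s\<in>{1..nstates M}. \<forall>b\<in>budgets M f g.
            max_ninf ((\<lambda>a. ereal (reward M h s a) + val_hat M f g id id h s a b 1 0) ` actions M h s)
            = opt_val M f g h s b)"
proof (intro conjI ballI allI)
  fix h s b a F t
  assume *: "h \<in> {1..horizon M}" "s \<in> {1..nstates M}" "a \<in> actions M h s" "t \<in> {1..nstates M + 1}"
  show "val_hat M f g (round_up l) \<kappa> h s a b t F =
      max_ninf {\<Sum>s'=t..nstates M.
          ereal (trans_prob M h s a s') * opt_val M f g (h + 1) s' (\<b> s') | \<b>.
        \<b> \<in> {t..nstates M} \<rightarrow>\<^sub>E budgets M f g \<and>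
        cost M h s a + agg_hat M f g (round_up l) h s a \<b> t F \<le> \<kappa> b}"
    unfolding val_hat_eq_max_ninf[OF assms(1) *] by (rule arg_cong[where f = max_ninf]) blast
qed (rule opt_val_eq_max_val_hat[OF assms(1,2)])

end
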